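(* Up to isomorphism (relabelling of the ground set), the trace-minimal non-convex-geometries of stem size 2 are exactly the following 15 families of rooted sets (distinct letters denote distinct elements). \begin{itemize} \item On a ground set $\{x,y,z\}$ of size 3 (two families): (1) $\{(\{x,y\},z),(\{x,z\},y)\}$; (2) $\{(\{x,y\},z),(\{x,z\},y),(\{y,z\},x)\}$. \item On a ground set $\{a,b,c,d\}$ of size 4, with two rooted sets (two families): (3) $\{(\{c,d\},b),(\{a,d\},c)\}$; (4) $\{(\{c,d\},b),(\{a,b\},d)\}$. \item On a ground set $\{a,b,c,d\}$ of size 4, with three rooted sets (five families): (5) $\{(\{c,d\},b),(\{a,d\},c),(\{a,b\},d)\}$; (6) $\{(\{c,d\},b),(\{a,c\},d),(\{a,b\},d)\}$; (7) $\{(\{b,d\},c),(\{a,d\},c),(\{a,b\},d)\}$; (8) $\{(\{c,d\},b),(\{a,d\},c),(\{b,d\},a)\}$; (9) $\{(\{c,d\},b),(\{c,d\},a),(\{a,b\},d)\}$. \item On a ground set $\{a,b,c,d\}$ of size 4, with four rooted sets (four families): (10) $\{(\{c,d\},b),(\{a,d\},c),(\{a,b\},d),(\{b,c\},a)\}$; (11) $\{(\{c,d\},b),(\{c,d\},a),(\{a,b\},d),(\{a,b\},c)\}$; (12) $\{(\{c,d\},b),(\{a,d\},c),(\{b,d\},a),(\{b,c\},a)\}$; (13) $\{(\{c,d\},b),(\{c,d\},a),(\{b,d\},a),(\{a,b\},c)\}$. \item On a ground set $\{x,y,z,u,v\}$ of size 5 (two families): (14) $\{(\{x,y\},z),(\{z,v\},u)\}$;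 (15) $\{(\{x,y\},z),(\{z,v\},u),(\{x,y\},v)\}$. \end{itemize}
   Context: $E$ is a finite set. A family $\mathcal{K}$ of subsets of $E$ is a closure system if $E\in\mathcal{K}$ and $A,B\in\mathcal{K}$ implies $A\cap B\in\mathcal{K}$. Its closure operator is $\tau(X)=\bigcap\{A\in\mathcal{K}: X\subseteq A\}$ and its extreme operator is $\mathrm{ex}(X)=\{x\in X: x\notin\tau(X\setminus\{x\})\}$. A closure system is a convex geometry if $\mathrm{ex}(X)\neq\emptyset$ for every non-empty $X\in\mathcal{K}$. A rooted set is a pair $(X,e)$ with $X\subseteq E$, $e\in E$, $e\notin X$ ($X$ is the stem, $e$ the root). A rooted set $(X,e)$ is a rooted circuit of $\mathcal{K}$ if $X$ is an inclusion-minimal set with $e\in\tau(X)$. For a family $\mathcal{C}$ of rooted sets on $E$ and $T\subseteq E$, the trace $\mathcal{C}:T=\{(X,e)\in\mathcal{C}: X\subseteq T,\ e\in T\}$ is regarded as a family of rooted sets on the ground set $T$. A family $\mathcal{C}$ of rooted sets on $E$, all of whose stems have exactly two elements, is a trace-minimal non-convex-geometry of stem size 2 if (1) $\mathcal{C}$ is not the family of rooted circuits of any convex geometry on $E$, and (2) for every proper subset $T\subsetneq E$, $\mathcal{C}:T$ is the family of rooted circuits of a convex geometry on $T$.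
   Formalization: A convex geometry is also required to satisfy τ(ex(X)) = X for every non-empty X in K (the standard notion); with only ex(X) ≠ ∅ the claim fails, since K = {∅,{x},{y},{z},{y,z},{x,y,z}} has family (1) as its rooted circuits. *)

theory Defs
  imports Main
begin

definition closure_system :: "'a set \<Rightarrow> 'a set set \<Rightarrow> bool" where
  "closure_system E K \<longleftrightarrow> K \<subseteq> Pow E \<and> E \<in> K \<and> (\<forall>A\<in>K. \<forall>B\<in>K. A \<inter> B \<in> K)"

definition closure_op :: "'a set set \<Rightarrow> 'a set \<Rightarrow> 'a set" where
  "closure_op K X = \<Inter>{A \<in> K. X \<subseteq> A}"

definition extreme_op :: "'a set set \<Rightarrow> 'a set \<Rightarrow> 'a set" where
  "extreme_op K X = {x \<in> X. x \<notin> closure_op K (X - {x})}"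

(* A convex geometry is usually defined, as here, by the requirement that every closed set is the
   closure of its extreme points; the non-emptiness clause forces the empty set to be closed.
   Non-emptiness of the extreme sets alone is strictly weaker:
   K = {{}, {x}, {y}, {z}, {y,z}, {x,y,z}} satisfies it, although the extreme points of {x,y,z}
   are just {x}, whose closure is {x}, and the anti-exchange property fails at {x}. The rooted
   circuits of this K are ({x,y},z) and ({x,z},y). *)
definition convex_geometry :: "'a set \<Rightarrow> 'a set set \<Rightarrow> bool" where
  "convex_geometry E K \<longleftrightarrow> closure_system E K \<and>
     (\<forall>X\<in>K. X \<noteq> {} \<longrightarrow> extreme_op K X \<noteq> {} \<and> closure_op K (extreme_op K X) = X)"

definition rooted_sets :: "'a set \<Rightarrow> ('a set \<times> 'a) set" where
  "rooted_sets E = {(X, e). X \<subseteq> E \<and> e \<in> E \<and> e \<notin> X}"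

definition rooted_circuits :: "'a set \<Rightarrow> 'a set set \<Rightarrow> ('a set \<times> 'a) set" where
  "rooted_circuits E K = {(X, e) \<in> rooted_sets E.
     e \<in> closure_op K X \<and> (\<forall>Y. Y \<subset> X \<longrightarrow> e \<notin> closure_op K Y)}"

definition circuits_of_convex_geometry :: "'a set \<Rightarrow> ('a set \<times> 'a) set \<Rightarrow> bool" where
  "circuits_of_convex_geometry E C \<longleftrightarrow> (\<exists>K. convex_geometry E K \<and> C = rooted_circuits E K)"

definition trace_family :: "('a set \<times> 'a) set \<Rightarrow> 'a set \<Rightarrow> ('a set \<times> 'a) set" where
  "trace_family C T = {(X, e) \<in> C. X \<subseteq> T \<and> e \<in> T}"

definition trace_minimal_non_convex_geometry2 :: "'a set \<Rightarrow> ('a set \<times> 'a) set \<Rightarrow> bool" where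
  "trace_minimal_non_convex_geometry2 E C \<longleftrightarrow>
     C \<subseteq> rooted_sets E \<and> (\<forall>(X, e)\<in>C. card X = 2) \<and>
     \<not> circuits_of_convex_geometry E C \<and>
     (\<forall>T. T \<subset> E \<longrightarrow> circuits_of_convex_geometry T (trace_family C T))"

definition isomorphic ::
  "'a set \<times> ('a set \<times> 'a) set \<Rightarrow> 'b set \<times> ('b set \<times> 'b) set \<Rightarrow> bool" where
  "isomorphic P Q \<longleftrightarrow>
     (\<exists>f. bij_betw f (fst P) (fst Q) \<and> snd Q = (\<lambda>(X, e). (f ` X, f e)) ` snd P)"

definition minimal_families :: "(nat set \<times> (nat set \<times> nat) set) list" where
  "minimal_families =
    (let x = 0; y = 1; z = 2; u = 3; v = 4; a = 0; b = 1; c = 2; d = 3 in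
     [({x,y,z}, {({x,y},z), ({x,z},y)}),
      ({x,y,z}, {({x,y},z), ({x,z},y), ({y,z},x)}),

      ({a,b,c,d}, {({c,d},b), ({a,d},c)}),
      ({a,b,c,d}, {({c,d},b), ({a,b},d)}),

      ({a,b,c,d}, {({c,d},b), ({a,d},c), ({a,b},d)}),
      ({a,b,c,d}, {({c,d},b), ({a,c},d), ({a,b},d)}),
      ({a,b,c,d}, {({b,d},c), ({a,d},c), ({a,b},d)}),
      ({a,b,c,d}, {({c,d},b), ({a,d},c), ({b,d},a)}),
      ({a,b,c,d}, {({c,d},b), ({c,d},a), ({a,b},d)}),

      ({a,b,c,d}, {({c,d},b), ({a,d},c), ({a,b},d), ({b,c},a)}),
      ({a,b,c,d}, {({c,d},b), ({c,d},a), ({a,b},d), ({a,b},c)}),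
      ({a,b,c,d}, {({c,d},b), ({a,d},c), ({b,d},a), ({b,c},a)}),
      ({a,b,c,d}, {({c,d},b), ({c,d},a), ({b,d},a), ({a,b},c)}),

      ({x,y,z,u,v}, {({x,y},z), ({z,v},u)}),
      ({x,y,z,u,v}, {({x,y},z), ({z,v},u), ({x,y},v)})])"

end

theory Submission
  imports Defs
begin

text \<open>
  The circuits of a convex geometry can be eliminated: whenever \<open>(X, e)\<close> and \<open>(X', e')\<close> are rooted
  circuits with \<open>e \<in> X'\<close>, some rooted circuit \<open>(S, e')\<close> has \<open>S \<subseteq> X \<union> X' - {e}\<close>. This is
  the anti-exchange property in disguise. Conversely, this property makes a family with non-empty
  stems that are pairwise incomparable for each root the family of circuits of a convex geometry
  (\<open>circuits_of_convex_geometry_iff\<close>): elimination removes the derived elements from a stem one by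
  one, so a single circuit always suffices to derive an element, and no derivation ever needs an
  element that is not extreme.

  Whether a pair of circuits fails this property depends only on the trace on the support
  \<open>X \<union> X' \<union> {e'}\<close> of the pair. So the traces of a family inherit precisely those failing pairs
  whose support they contain, and a family is trace-minimal if and only if it has a failing pair and
  every failing pair has the whole ground set as its support (\<open>trace_minimal_iff\<close>). This form of
  trace-minimality is decided by evaluation for each of the 15 families and is visibly invariant
  under relabelling.

  For stems of size 2 the support has three, four or five elements, which leaves a finite problem.
  Since pairs with smaller support never fail, elimination can be used freely on fewer elements than
  the ground set has. On four elements, elimination on three elements says that every triple carries
  at most one circuit. A failing pair occupies two of the four triples and forbids one root in a
  third, so there are 3 * 4 completions for each of the two shapes of a failing pair; each of them is
  a relabelling of a listed family. On five elements the failing pair is \<open>({x, y}, z)\<close> with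
  \<open>({z, v}, u)\<close>, and any further circuit except \<open>({x, y}, v)\<close> would either share a triple with
  one of these two or lead, by repeated elimination, to a circuit whose absence makes the pair fail.

  The listed families are told apart by the size of the ground set, the number of rooted sets, and
  two counts in the digraph that joins a rooted set to those whose stems contain its root.
\<close>

section \<open>Circuit elimination\<close>

text \<open>
  Every stem in a family of rooted sets avoids its root, so the requirement \<open>S \<subseteq> X \<union> X' - {e}\<close>
  for a rooted set \<open>(S, e')\<close> also keeps \<open>e'\<close> out of \<open>S\<close>.
\<close>

definition elimination_failures ::
  "('a set \<times> 'a) set \<Rightarrow> (('a set \<times> 'a) \<times> ('a set \<times> 'a)) set" where
  "elimination_failures C =
     {((X, e), (X', e')). (X, e) \<in> C \<and> (X', e') \<in> C \<and> e \<in> X' \<and>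
        (\<forall>(S, f)\<in>C. f = e' \<longrightarrow> \<not> S \<subseteq> X \<union> X' - {e})}"

text \<open>
  The elements that a failing pair involves; its first root lies in the second stem.
\<close>
definition support :: "('a set \<times> 'a) \<times> ('a set \<times> 'a) \<Rightarrow> 'a set" where
  "support pq = fst (fst pq) \<union> fst (snd pq) \<union> {snd (snd pq)}"

lemma mem_elimination_failures_iff:
  "((X, e), (X', e')) \<in> elimination_failures C \<longleftrightarrow>
     (X, e) \<in> C \<and> (X', e') \<in> C \<and> e \<in> X' \<and> (\<forall>S\<subseteq>X \<union> X' - {e}. (S, e') \<notin> C)"
proof -
  have "(\<forall>(S, f)\<in>C. f = e' \<longrightarrow> \<not> S \<subseteq> Y) \<longleftrightarrow> (\<forall>S\<subseteq>Y. (S, e') \<notin> C)" for Y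
    by blast
  then show ?thesis by (simp add: elimination_failures_def)
qed

lemma no_elimination_failures_iff:
  "elimination_failures C = {} \<longleftrightarrow>
     (\<forall>X e X' e'. (X, e) \<in> C \<and> (X', e') \<in> C \<and> e \<in> X' \<longrightarrow>
        (\<exists>S\<subseteq>X \<union> X' - {e}. (S, e') \<in> C))"
proof -
  have "((X, e), (X', e')) \<notin> elimination_failures C \<longleftrightarrow>
      ((X, e) \<in> C \<and> (X', e') \<in> C \<and> e \<in> X' \<longrightarrow> (\<exists>S\<subseteq>X \<union> X' - {e}. (S, e') \<in> C))"
    for X e X' e'
    unfolding mem_elimination_failures_iff
    by (cases "e \<in> X'"; cases "(X, e) \<in> C"; cases "(X', e') \<in> C"; simp)
  then show ?thesis
    by (simp only: all_not_in_conv[symmetric] split_paired_All)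
qed

section \<open>Circuits of convex geometries satisfy elimination\<close>

lemma closure_op_extensive: "X \<subseteq> closure_op K X"
  by (auto simp: closure_op_def)

lemma closure_op_mono: "X \<subseteq> Y \<Longrightarrow> closure_op K X \<subseteq> closure_op K Y"
  by (auto simp: closure_op_def)

lemma closure_op_least: "A \<in> K \<Longrightarrow> X \<subseteq> A \<Longrightarrow> closure_op K X \<subseteq> A"
  by (auto simp: closure_op_def)

lemma closure_op_closed:
  assumes "finite E" "closure_system E K" "X \<subseteq> E"
  shows "closure_op K X \<in> K"
proof -
  have cap: "\<Inter>F \<in> K" if "finite F" "F \<noteq> {}" "F \<subseteq> K" for F
    using that assms(2) by (induction F rule: finite_ne_induct) (auto simp: closure_system_def)
  have "finite K" "E \<in> K"
    using assms finite_subset[of K "Pow E"] by (auto simp: closure_system_def)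
  then show ?thesis
    unfolding closure_op_def using assms(3) by (intro cap) auto
qed

lemma closure_op_subset_iff:
  assumes "finite E" "closure_system E K" "Y \<subseteq> E"
  shows "closure_op K X \<subseteq> closure_op K Y \<longleftrightarrow> X \<subseteq> closure_op K Y"
proof
  show "X \<subseteq> closure_op K Y" if "closure_op K X \<subseteq> closure_op K Y"
    using closure_op_extensive that by (rule order_trans)
  show "closure_op K X \<subseteq> closure_op K Y" if "X \<subseteq> closure_op K Y"
    using closure_op_closed[OF assms] that by (rule closure_op_least)
qed

text \<open>
  By hypothesis \<open>insert a Z\<close> and \<open>insert b Z\<close> generate the same closed set. Its extreme points belong
  to each of its generating sets, hence to \<open>Z\<close>; as they generate the closed set, so does \<open>Z\<close>.
\<close>
lemma anti_exchange:
  assumes "finite E" "convex_geometry E K" "Z \<subseteq> E" "a \<in> E" "b \<in> E" "a \<noteq> b"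
    and ab: "a \<in> closure_op K (insert b Z)" and ba: "b \<in> closure_op K (insert a Z)"
  shows "a \<in> closure_op K Z"
proof -
  let ?cl = "closure_op K"
  have sys: "closure_system E K"
    using assms(2) by (simp add: convex_geometry_def)
  define Y where "Y = ?cl (insert a Z)"
  have Y: "Y \<in> K"
    unfolding Y_def using assms by (intro closure_op_closed[OF _ sys]) auto
  have Yb: "Y = ?cl (insert b Z)"
    unfolding Y_def using assms closure_op_extensive[of "insert a Z" K]
      closure_op_extensive[of "insert b Z" K]
    by (intro equalityI; subst closure_op_subset_iff[OF assms(1) sys]) auto
  have "x \<in> W" if "x \<in> extreme_op K Y" "Y = ?cl W" for x W
    using that closure_op_mono[of W "Y - {x}" K] closure_op_extensive[of W K]
    by (auto simp: extreme_op_def)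
  then have "extreme_op K Y \<subseteq> insert a Z \<inter> insert b Z"
    using Y_def Yb by blast
  then have "?cl (extreme_op K Y) \<subseteq> ?cl Z"
    using \<open>a \<noteq> b\<close> by (intro closure_op_mono) auto
  moreover have "Y = {} \<or> ?cl (extreme_op K Y) = Y"
    using Y assms(2) by (auto simp: convex_geometry_def)
  moreover have "a \<in> Y"
    unfolding Y_def using closure_op_extensive[of "insert a Z" K] by simp
  ultimately show ?thesis by (metis empty_iff subsetD)
qed

lemma rooted_circuit_below:
  assumes "finite E" "X \<subseteq> E" "e \<in> E" "e \<in> closure_op K X" "e \<notin> X"
  obtains Y where "Y \<subseteq> X" "(Y, e) \<in> rooted_circuits E K"
proof -
  let ?F = "{Y. Y \<subseteq> X \<and> e \<in> closure_op K Y}"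
  have "finite ?F"
    using assms(1,2) by (auto intro: rev_finite_subset[of "Pow E"])
  then obtain Y where "Y \<in> ?F" and min: "\<forall>Z\<in>?F. Z \<subseteq> Y \<longrightarrow> Y = Z"
    using finite_has_minimal2[of ?F X] assms(4) by auto
  then have "Y \<subseteq> X" "e \<in> closure_op K Y" by auto
  moreover have "e \<notin> closure_op K Z" if "Z \<subset> Y" for Z
    using that min \<open>Y \<subseteq> X\<close> by auto
  ultimately have "(Y, e) \<in> rooted_circuits E K"
    using assms(2,3,5) by (auto simp: rooted_circuits_def rooted_sets_def)
  with \<open>Y \<subseteq> X\<close> show ?thesis by (rule that)
qed

text \<open>
  Let \<open>Z\<close> be \<open>X \<union> X'\<close> without the two roots. Each root is generated by \<open>Z\<close> together with the other
  one, so anti-exchange puts both of them into the closure of \<open>Z\<close>. A minimal subset of \<open>Z\<close> that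
  generates \<open>e'\<close> is the stem looked for.
\<close>
lemma no_failures_rooted_circuits:
  assumes "finite E" "convex_geometry E K"
  shows "elimination_failures (rooted_circuits E K) = {}"
proof -
  let ?cl = "closure_op K"
  have sys: "closure_system E K"
    using assms(2) by (simp add: convex_geometry_def)
  have "\<exists>S \<subseteq> X \<union> X' - {e}. (S, e') \<in> rooted_circuits E K"
    if C: "(X, e) \<in> rooted_circuits E K" "(X', e') \<in> rooted_circuits E K" and "e \<in> X'" for X e X' e'
  proof -
    define Z where "Z = X \<union> X' - {e, e'}"
    have X: "X \<subseteq> E" "e \<in> E" "e \<notin> X" "e \<in> ?cl X"
      and X': "X' \<subseteq> E" "e' \<in> E" "e' \<notin> X'" "e' \<in> ?cl X'"
      using C by (auto simp: rooted_circuits_def rooted_sets_def)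
    have Z: "Z \<subseteq> E" "insert e Z \<subseteq> E" "insert e' Z \<subseteq> E" using X X' by (auto simp: Z_def)
    have "e \<in> ?cl (insert e' Z)"
      using X closure_op_mono[of X "insert e' Z" K] by (auto simp: Z_def)
    moreover have e': "e' \<in> ?cl (insert e Z)"
      using X' closure_op_mono[of X' "insert e Z" K] by (auto simp: Z_def)
    ultimately have "e \<in> ?cl Z"
      using X X' Z \<open>e \<in> X'\<close> by (intro anti_exchange[OF assms, of Z e e']) auto
    then have "?cl (insert e Z) \<subseteq> ?cl Z"
      using closure_op_extensive[of Z K] by (subst closure_op_subset_iff[OF assms(1) sys Z(1)]) auto
    then have "e' \<in> ?cl Z" using e' by blast
    moreover have "e' \<notin> Z" by (simp add: Z_def)
    ultimately obtain S where "S \<subseteq> Z" "(S, e') \<in> rooted_circuits E K"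
      using rooted_circuit_below[OF assms(1) Z(1)] X' by metis
    then show ?thesis by (auto simp: Z_def)
  qed
  then show ?thesis
    unfolding no_elimination_failures_iff by simp
qed

section \<open>Families with elimination come from convex geometries\<close>

definition closed_sets :: "'a set \<Rightarrow> ('a set \<times> 'a) set \<Rightarrow> 'a set set" where
  "closed_sets E C = {X. X \<subseteq> E \<and> (\<forall>(S, e)\<in>C. S \<subseteq> X \<longrightarrow> e \<in> X)}"

text \<open>
  The engine of the converse: elements of a stem outside \<open>Y\<close> that can be derived from \<open>Y\<close> by one
  rooted set are eliminated one after another. Each elimination adds only elements of \<open>Y\<close>, so the
  part of the stem outside \<open>Y\<close> shrinks.
\<close>
lemma resolve_stem:
  assumes elim: "elimination_failures C = {}"
    and fin: "finite (S - Y)" and S: "(S, e) \<in> C"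
    and derivable: "\<And>s. s \<in> S \<Longrightarrow> s \<in> Y \<or> (\<exists>R\<subseteq>Y. (R, s) \<in> C)"
  shows "\<exists>R\<subseteq>Y. (R, e) \<in> C"
  using fin S derivable
proof (induction "card (S - Y)" arbitrary: S rule: less_induct)
  case less
  show ?case
  proof (cases "S \<subseteq> Y")
    case False
    then obtain s R where s: "s \<in> S" "s \<notin> Y" and R: "R \<subseteq> Y" "(R, s) \<in> C"
      using less.prems(3) by blast
    have "\<exists>S'\<subseteq>R \<union> S - {s}. (S', e) \<in> C"
      using elim[unfolded no_elimination_failures_iff, rule_format, of R s S e]
        R(2) less.prems(2) s(1) by simp
    then obtain S' where S': "(S', e) \<in> C" "S' \<subseteq> R \<union> S - {s}" by auto
    have sub: "S' - Y \<subset> S - Y" using S' s R by blast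
    show ?thesis
    proof (rule less.hyps[OF _ _ S'(1)])
      show "card (S' - Y) < card (S - Y)"
        using sub less.prems(1) by (intro psubset_card_mono) auto
      show "finite (S' - Y)"
        using sub less.prems(1) finite_subset by blast
      show "t \<in> Y \<or> (\<exists>R\<subseteq>Y. (R, t) \<in> C)" if "t \<in> S'" for t
        using that S' R less.prems(3) by blast
    qed
  qed (use less.prems in blast)
qed

text \<open>
  By \<open>resolve_stem\<close> a derivation in several steps can be replaced by a derivation in one step, so
  adding the roots of all stems inside \<open>X\<close> already gives a closed set.
\<close>
lemma closure_op_closed_sets:
  assumes fin: "finite E" and C: "C \<subseteq> rooted_sets E" and elim: "elimination_failures C = {}"
    and "X \<subseteq> E"
  shows "closure_op (closed_sets E C) X = X \<union> {e. \<exists>S\<subseteq>X. (S, e) \<in> C}" (is "_ = ?X")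
proof
  have "?X \<in> closed_sets E C"
    unfolding closed_sets_def mem_Collect_eq
  proof (intro conjI)
    show "?X \<subseteq> E" using C \<open>X \<subseteq> E\<close> by (auto simp: rooted_sets_def)
    have "\<exists>R\<subseteq>X. (R, e) \<in> C" if "(S, e) \<in> C" "S \<subseteq> ?X" for S e
      using that C fin by (intro resolve_stem[OF elim, of S])
        (auto simp: rooted_sets_def intro: rev_finite_subset)
    then show "\<forall>(S, e)\<in>C. S \<subseteq> ?X \<longrightarrow> e \<in> ?X" by blast
  qed
  then show "closure_op (closed_sets E C) X \<subseteq> ?X"
    by (rule closure_op_least) blast
  show "?X \<subseteq> closure_op (closed_sets E C) X"
    by (fastforce simp: closure_op_def closed_sets_def)
qed

text \<open>
  The elements of \<open>X\<close> that are not extreme can be deleted one at a time without losing the closure: a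
  rooted set showing that \<open>s\<close> is not extreme may use elements that were deleted earlier, but
  \<open>resolve_stem\<close> replaces those.
\<close>
lemma convex_geometry_closed_sets:
  assumes fin: "finite E" and C: "C \<subseteq> rooted_sets E" and elim: "elimination_failures C = {}"
    and ne: "\<forall>(S, e)\<in>C. S \<noteq> {}"
  shows "convex_geometry E (closed_sets E C)"
proof -
  let ?K = "closed_sets E C"
  let ?cl = "closure_op ?K"
  note cl = closure_op_closed_sets[OF fin C elim]
  have sys: "closure_system E ?K"
    using C by (auto simp: closure_system_def closed_sets_def rooted_sets_def)
  have extreme: "?cl (extreme_op ?K X) = X" if X: "X \<in> ?K" for X
  proof -
    have "X \<subseteq> E" using X by (auto simp: closed_sets_def)
    then have "finite X" using fin finite_subset by blast
    have "X \<subseteq> ?cl (X - N)" if "finite N" "N \<subseteq> X - extreme_op ?K X" for N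
      using that
    proof (induction N rule: finite_induct)
      case empty
      then show ?case using closure_op_extensive by simp
    next
      case (insert s N)
      have sub: "X - N \<subseteq> E" "X - insert s N \<subseteq> E" "X - {s} \<subseteq> E" using \<open>X \<subseteq> E\<close> by auto
      have "s \<in> X" "s \<in> ?cl (X - {s})" using insert.prems by (auto simp: extreme_op_def)
      then obtain S where S: "S \<subseteq> X - {s}" "(S, s) \<in> C" by (auto simp: cl[OF sub(3)])
      have "t \<in> X - N \<or> (\<exists>R\<subseteq>X - N. (R, t) \<in> C)" if "t \<in> S" for t
        using that S insert by (auto simp: cl[OF sub(1)])
      then obtain R where R: "R \<subseteq> X - N" "(R, s) \<in> C"
        using resolve_stem[OF elim _ S(2)] S(1) \<open>finite X\<close>
        by (meson finite_Diff finite_subset)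
      then have "s \<notin> R" using C by (auto simp: rooted_sets_def)
      with R have "s \<in> ?cl (X - insert s N)"
        by (auto simp: cl[OF sub(2)])
      then have "X - N \<subseteq> ?cl (X - insert s N)"
        using closure_op_extensive[of "X - insert s N" ?K] by blast
      then have "?cl (X - N) \<subseteq> ?cl (X - insert s N)"
        by (subst closure_op_subset_iff[OF fin sys sub(2)])
      moreover have "X \<subseteq> ?cl (X - N)" using insert by simp
      ultimately show ?case by blast
    qed
    from this[of "X - extreme_op ?K X"] \<open>finite X\<close>
    have "X \<subseteq> ?cl (X - (X - extreme_op ?K X))" by blast
    also have "X - (X - extreme_op ?K X) = extreme_op ?K X"
      by (auto simp: extreme_op_def)
    finally show ?thesis
      using closure_op_least[OF X, of "extreme_op ?K X"] by (auto simp: extreme_op_def)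
  qed
  have "?cl {} = {}" using ne by (auto simp: cl)
  then show ?thesis
    using sys extreme by (fastforce simp: convex_geometry_def)
qed

lemma rooted_circuits_closed_sets:
  assumes fin: "finite E" and C: "C \<subseteq> rooted_sets E" and elim: "elimination_failures C = {}"
    and antichain: "\<And>S R e. (S, e) \<in> C \<Longrightarrow> (R, e) \<in> C \<Longrightarrow> \<not> R \<subset> S"
  shows "rooted_circuits E (closed_sets E C) = C"
proof -
  note cl = closure_op_closed_sets[OF fin C elim]
  have "(X, e) \<in> rooted_circuits E (closed_sets E C) \<longleftrightarrow> (X, e) \<in> C" for X e
  proof
    assume *: "(X, e) \<in> rooted_circuits E (closed_sets E C)"
    then have "X \<subseteq> E" "e \<notin> X" "e \<in> closure_op (closed_sets E C) X"
      by (auto simp: rooted_circuits_def rooted_sets_def)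
    then obtain S where S: "S \<subseteq> X" "(S, e) \<in> C" by (auto simp: cl)
    then have "e \<in> closure_op (closed_sets E C) S" using \<open>X \<subseteq> E\<close> by (subst cl) auto
    then have "\<not> S \<subset> X" using * by (auto simp: rooted_circuits_def)
    then show "(X, e) \<in> C" using S by auto
  next
    assume *: "(X, e) \<in> C"
    then have "(X, e) \<in> rooted_sets E" using C by blast
    moreover have "e \<notin> closure_op (closed_sets E C) Y" if "Y \<subset> X" for Y
    proof -
      have "Y \<subseteq> E" "e \<notin> Y" using that \<open>(X, e) \<in> rooted_sets E\<close> by (auto simp: rooted_sets_def)
      moreover have "(S, e) \<notin> C" if "S \<subseteq> Y" for S
        using that \<open>Y \<subset> X\<close> * antichain by blast
      ultimately show ?thesis by (simp add: cl)
    qed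
    ultimately show "(X, e) \<in> rooted_circuits E (closed_sets E C)"
      using * by (auto simp: rooted_circuits_def rooted_sets_def cl)
  qed
  then show ?thesis by auto
qed

text \<open>
  A version of Dietrich's axioms for rooted circuits. Incomparability for each root ensures that the
  members of \<open>C\<close> are minimal among all stems that derive their roots.
\<close>
theorem circuits_of_convex_geometry_iff:
  assumes "finite E" "C \<subseteq> rooted_sets E" "\<forall>(S, e)\<in>C. S \<noteq> {}"
    and "\<And>S R e. (S, e) \<in> C \<Longrightarrow> (R, e) \<in> C \<Longrightarrow> \<not> R \<subset> S"
  shows "circuits_of_convex_geometry E C \<longleftrightarrow> elimination_failures C = {}"
proof
  show "elimination_failures C = {}" if "circuits_of_convex_geometry E C"
    using that no_failures_rooted_circuits[OF assms(1)]
    by (auto simp: circuits_of_convex_geometry_def)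
  show "circuits_of_convex_geometry E C" if "elimination_failures C = {}"
    using convex_geometry_closed_sets[OF assms(1,2) that assms(3)]
      rooted_circuits_closed_sets[OF assms(1,2) that assms(4)]
    by (auto simp: circuits_of_convex_geometry_def)
qed

section \<open>Trace-minimality in terms of failing pairs\<close>

text \<open>
  A rooted set that would repair a failing pair lies inside the support of the pair, so passing to a
  trace that contains the support neither repairs nor breaks the pair.
\<close>
lemma elimination_failures_trace:
  "elimination_failures (trace_family C T) = {pq \<in> elimination_failures C. support pq \<subseteq> T}"
proof -
  have "((X, e), (X', e')) \<in> elimination_failures (trace_family C T) \<longleftrightarrow>
      ((X, e), (X', e')) \<in> elimination_failures C \<and> support ((X, e), (X', e')) \<subseteq> T" for X e X' e'
  proof (cases "X \<union> X' \<union> {e'} \<subseteq> T \<and> e \<in> X'")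
    case True
    then have "(S, e') \<in> trace_family C T \<longleftrightarrow> (S, e') \<in> C" if "S \<subseteq> X \<union> X' - {e}" for S
      using that by (auto simp: trace_family_def)
    moreover have "(X, e) \<in> trace_family C T \<longleftrightarrow> (X, e) \<in> C"
      "(X', e') \<in> trace_family C T \<longleftrightarrow> (X', e') \<in> C"
      using True by (auto simp: trace_family_def)
    ultimately show ?thesis
      using True unfolding mem_elimination_failures_iff by (simp add: support_def)
  next
    case False
    then show ?thesis
      unfolding mem_elimination_failures_iff support_def by (auto simp: trace_family_def)
  qed
  then show ?thesis by (intro set_eqI) (simp add: split_paired_all)
qed

lemma trace_minimal_iff:
  assumes "finite E" "C \<subseteq> rooted_sets E" "\<forall>(X, e)\<in>C. card X = 2"
  shows "trace_minimal_non_convex_geometry2 E C \<longleftrightarrow> support ` elimination_failures C = {E}"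
proof -
  have geometry: "circuits_of_convex_geometry T (trace_family C T) \<longleftrightarrow>
      (\<forall>pq\<in>elimination_failures C. \<not> support pq \<subseteq> T)" if "T \<subseteq> E" for T
  proof -
    have "circuits_of_convex_geometry T (trace_family C T) \<longleftrightarrow>
        elimination_failures (trace_family C T) = {}"
    proof (rule circuits_of_convex_geometry_iff)
      show "finite T" using that assms(1) finite_subset by blast
      show "trace_family C T \<subseteq> rooted_sets T"
        using assms(2) by (auto simp: trace_family_def rooted_sets_def)
      show "\<forall>(S, e)\<in>trace_family C T. S \<noteq> {}"
        using assms(3) by (auto simp: trace_family_def)
      show "\<not> R \<subset> S" if "(S, e) \<in> trace_family C T" "(R, e) \<in> trace_family C T" for S R e
      proof -
        have "card S = 2" "card R = 2" using that assms(3) by (auto simp: trace_family_def)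
        then show ?thesis using psubset_card_mono[of S R] card.infinite[of S] by force
      qed
    qed
    then show ?thesis by (auto simp: elimination_failures_trace)
  qed
  have "trace_family C E = C"
    using assms(2) by (auto simp: trace_family_def rooted_sets_def)
  moreover have support: "support pq \<subseteq> E" if "pq \<in> elimination_failures C" for pq
    using that assms(2) by (fastforce simp: elimination_failures_def support_def rooted_sets_def)
  ultimately have not_geometry:
    "\<not> circuits_of_convex_geometry E C \<longleftrightarrow> elimination_failures C \<noteq> {}"
    using geometry[of E] by auto
  have "(\<forall>T. T \<subset> E \<longrightarrow> circuits_of_convex_geometry T (trace_family C T)) \<longleftrightarrow>
      (\<forall>pq\<in>elimination_failures C. \<forall>T. T \<subset> E \<longrightarrow> \<not> support pq \<subseteq> T)"
    using geometry by auto
  also have "\<dots> \<longleftrightarrow> (\<forall>pq\<in>elimination_failures C. support pq = E)"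
    using support by blast
  finally have "trace_minimal_non_convex_geometry2 E C \<longleftrightarrow>
      elimination_failures C \<noteq> {} \<and> (\<forall>pq\<in>elimination_failures C. support pq = E)"
    using assms(2,3) not_geometry unfolding trace_minimal_non_convex_geometry2_def by simp
  then show ?thesis by auto
qed

section \<open>Relabelling\<close>

lemma relation_eq_map_prod_image:
  assumes "R' \<subseteq> r ` A \<times> r ` A" "R \<subseteq> A \<times> A"
    and iff: "\<And>p q. p \<in> A \<Longrightarrow> q \<in> A \<Longrightarrow> (r p, r q) \<in> R' \<longleftrightarrow> (p, q) \<in> R"
  shows "R' = map_prod r r ` R"
proof (intro equalityI subsetI)
  fix x assume "x \<in> R'"
  moreover from this obtain p q where "p \<in> A" "q \<in> A" "x = (r p, r q)"
    using assms(1) by blast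
  ultimately show "x \<in> map_prod r r ` R"
    using iff[of p q] by (auto intro!: rev_image_eqI[of "(p, q)"])
next
  fix x assume "x \<in> map_prod r r ` R"
  then obtain p q where "(p, q) \<in> R" "x = (r p, r q)" by auto
  then show "x \<in> R'" using assms(2) iff[of p q] by auto
qed

definition relabel :: "('a \<Rightarrow> 'b) \<Rightarrow> 'a set \<times> 'a \<Rightarrow> 'b set \<times> 'b" where
  "relabel f = (\<lambda>(X, e). (f ` X, f e))"

lemma isomorphic_iff:
  "isomorphic (E, C) (E', C') \<longleftrightarrow> (\<exists>f. bij_betw f E E' \<and> C' = relabel f ` C)"
  by (simp add: isomorphic_def relabel_def)

lemma inj_on_relabel: "inj_on f E \<Longrightarrow> inj_on (relabel f) (rooted_sets E)"
  by (auto simp: inj_on_def relabel_def rooted_sets_def inj_on_image_eq_iff)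

lemma elimination_failures_relabel:
  assumes inj: "inj_on f E" and C: "C \<subseteq> rooted_sets E"
  shows "elimination_failures (relabel f ` C) =
    map_prod (relabel f) (relabel f) ` elimination_failures C"
proof -
  have mem: "relabel f (S, g) \<in> relabel f ` C \<longleftrightarrow> (S, g) \<in> C" if "(S, g) \<in> rooted_sets E" for S g
    using inj_on_image_mem_iff[OF inj_on_relabel[OF inj] that C] .
  have "(relabel f (X, e), relabel f (X', e')) \<in> elimination_failures (relabel f ` C) \<longleftrightarrow>
      ((X, e), (X', e')) \<in> elimination_failures C"
    if XC: "(X, e) \<in> C" "(X', e') \<in> C" for X e X' e'
  proof -
    have sub: "X \<subseteq> E" "e \<in> E" "X' \<subseteq> E" "e' \<in> E"
      using XC C by (auto simp: rooted_sets_def)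
    have "f ` X \<union> f ` X' - {f e} = f ` (X \<union> X' - {e})"
      using sub inj by (subst inj_on_image_set_diff[OF inj]) auto
    moreover have "(f ` S, f e') \<in> relabel f ` C \<longleftrightarrow> (S, e') \<in> C" if "S \<subseteq> X \<union> X' - {e}" for S
    proof (cases "e' \<in> S")
      case True
      then have "(S, e') \<notin> C" using C by (auto simp: rooted_sets_def)
      moreover have "(f ` S, f e') \<notin> relabel f ` C"
      proof
        assume "(f ` S, f e') \<in> relabel f ` C"
        then obtain R g where R: "(R, g) \<in> C" "f ` S = f ` R" "f e' = f g"
          by (auto simp: relabel_def)
        then have "R \<subseteq> E" "g \<in> E" "g \<notin> R" using C by (auto simp: rooted_sets_def)
        moreover have "f g \<in> f ` R" using R True by (metis imageI)
        ultimately show False using inj by (simp add: inj_on_image_mem_iff)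
      qed
      ultimately show ?thesis by simp
    next
      case False
      then have "(S, e') \<in> rooted_sets E" using that sub by (auto simp: rooted_sets_def)
      then show ?thesis using mem[of S e'] by (simp add: relabel_def)
    qed
    moreover have "f e \<in> f ` X' \<longleftrightarrow> e \<in> X'"
      using sub inj by (simp add: inj_on_image_mem_iff)
    moreover have "(f ` X, f e) \<in> relabel f ` C" "(f ` X', f e') \<in> relabel f ` C"
      using imageI[OF XC(1), of "relabel f"] imageI[OF XC(2), of "relabel f"]
      by (simp_all add: relabel_def)
    ultimately show ?thesis
      using XC by (simp add: relabel_def mem_elimination_failures_iff all_subset_image)
  qed
  then have eq: "(relabel f p, relabel f q) \<in> elimination_failures (relabel f ` C) \<longleftrightarrow>
      (p, q) \<in> elimination_failures C" if "p \<in> C" "q \<in> C" for p q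
    using that by (cases p, cases q) simp
  have sub: "elimination_failures D \<subseteq> D \<times> D" for D :: "('c set \<times> 'c) set"
    by (auto simp: elimination_failures_def)
  show ?thesis
    using sub eq by (rule relation_eq_map_prod_image[OF _ sub])
qed

lemma trace_minimal_isomorphic:
  assumes iso: "isomorphic (E, C) (E', C')" and "finite E"
    and min: "trace_minimal_non_convex_geometry2 E C"
  shows "trace_minimal_non_convex_geometry2 E' C'"
proof -
  obtain f where f: "inj_on f E" "E' = f ` E" "C' = relabel f ` C"
    using iso by (auto simp: isomorphic_iff bij_betw_def)
  have C: "C \<subseteq> rooted_sets E" "\<forall>(X, e)\<in>C. card X = 2"
    using min by (auto simp: trace_minimal_non_convex_geometry2_def)
  have C': "C' \<subseteq> rooted_sets E'"
  proof (clarsimp simp: f(3))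
    fix X e assume "(X, e) \<in> C"
    then have "X \<subseteq> E" "e \<in> E" "e \<notin> X" using C by (auto simp: rooted_sets_def)
    then show "relabel f (X, e) \<in> rooted_sets E'"
      using f by (simp add: relabel_def rooted_sets_def inj_on_image_mem_iff image_mono)
  qed
  have two: "\<forall>(X, e)\<in>C'. card X = 2"
  proof clarify
    fix Y e assume "(Y, e) \<in> C'"
    then obtain X g where "(X, g) \<in> C" "Y = f ` X" unfolding f by (auto simp: relabel_def)
    moreover from this have "X \<subseteq> E" using C by (auto simp: rooted_sets_def)
    ultimately show "card Y = 2"
      using C(2) f(1) by (auto simp: card_image inj_on_subset)
  qed
  have "support (map_prod (relabel f) (relabel f) pq) = f ` support pq" for pq
    by (cases pq) (auto simp: support_def relabel_def)
  then have "support ` elimination_failures C' = image f ` support ` elimination_failures C"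
    unfolding f elimination_failures_relabel[OF f(1) C(1)] by (simp add: image_image)
  then show ?thesis
    using min trace_minimal_iff[OF \<open>finite E\<close> C] C' two f \<open>finite E\<close>
    by (subst trace_minimal_iff) auto
qed

section \<open>An invariant that separates the listed families\<close>

definition arcs :: "('a set \<times> 'a) set \<Rightarrow> (('a set \<times> 'a) \<times> ('a set \<times> 'a)) set" where
  "arcs C = {(p, q) \<in> C \<times> C. snd p \<in> fst q}"

text \<open>
  The number of arcs does not separate all listed families of equal size, but together with the number
  of mutual arcs it does.
\<close>
definition invariant :: "'a set \<times> ('a set \<times> 'a) set \<Rightarrow> nat \<times> nat \<times> nat \<times> nat" where
  "invariant = (\<lambda>(E, C). (card E, card C, card (arcs C), card (arcs C \<inter> (arcs C)\<inverse>)))"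

lemma invariant_isomorphic:
  assumes "isomorphic (E, C) (E', C')" and C: "C \<subseteq> rooted_sets E"
  shows "invariant (E, C) = invariant (E', C')"
proof -
  obtain f where f: "inj_on f E" "E' = f ` E" "C' = relabel f ` C"
    using assms by (auto simp: isomorphic_iff bij_betw_def)
  let ?r = "map_prod (relabel f) (relabel f)"
  have inj: "inj_on (relabel f) C"
    using inj_on_relabel[OF f(1)] C by (rule inj_on_subset)
  have arc: "snd (relabel f p) \<in> fst (relabel f q) \<longleftrightarrow> snd p \<in> fst q" if "p \<in> C" "q \<in> C" for p q
  proof -
    have "snd p \<in> E" "fst q \<subseteq> E"
      using that C by (cases p; cases q; auto simp: rooted_sets_def)+
    then show ?thesis using f(1) by (simp add: relabel_def split_beta inj_on_image_mem_iff)
  qed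
  have mem: "(relabel f p, relabel f q) \<in> arcs C' \<longleftrightarrow> (p, q) \<in> arcs C" if "p \<in> C" "q \<in> C" for p q
    using that by (simp add: arcs_def f arc)
  have sub: "arcs D \<subseteq> D \<times> D" for D :: "('c set \<times> 'c) set"
    by (auto simp: arcs_def)
  have "arcs C' = ?r ` arcs C"
    using sub[of C'] sub[of C] mem by (intro relation_eq_map_prod_image) (simp_all add: f)
  moreover have inj2: "inj_on ?r (C \<times> C)"
    using inj by (simp add: map_prod_inj_on)
  moreover have "arcs C' \<inter> (arcs C')\<inverse> = ?r ` (arcs C \<inter> (arcs C)\<inverse>)"
    using sub[of C] sub[of C'] mem
    by (intro relation_eq_map_prod_image) (auto simp: f)
  moreover have "arcs C \<subseteq> C \<times> C" by (rule sub)
  ultimately have "card (arcs C') = card (arcs C)"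
      "card (arcs C' \<inter> (arcs C')\<inverse>) = card (arcs C \<inter> (arcs C)\<inverse>)"
    by (simp_all add: card_image inj_on_subset[OF inj2] le_infI1)
  then show ?thesis
    using f inj by (simp add: invariant_def card_image)
qed

section \<open>Evaluation on the listed families\<close>

lemma minimal_families_rooted:
  "\<forall>(E, C)\<in>set minimal_families. finite E \<and> C \<subseteq> rooted_sets E \<and> (\<forall>(X, e)\<in>C. card X = 2)"
  by (simp add: minimal_families_def rooted_sets_def)

text \<open>
  As filters of a finite product, the sets of pairs become computable.
\<close>
lemma elimination_failures_code [code]:
  "elimination_failures C = Set.filter
     (\<lambda>((X, e), (X', e')). e \<in> X' \<and> (\<forall>(S, f)\<in>C. f = e' \<longrightarrow> \<not> S \<subseteq> X \<union> X' - {e})) (C \<times> C)"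
  by (auto simp: elimination_failures_def)

lemma arcs_code [code]: "arcs C = Set.filter (\<lambda>(p, q). snd p \<in> fst q) (C \<times> C)"
  by (auto simp: arcs_def)

lemma distinct_invariants: "distinct (map invariant minimal_families)"
  by code_simp

lemma minimal_families_failures:
  "list_all (\<lambda>(E, C). support ` elimination_failures C = {E}) minimal_families"
  by code_simp

section \<open>Minimal families on at most five elements\<close>

lemma two_subset_of_four:
  assumes "X \<subseteq> {a, b, c, d}" "card X = 2"
  shows "X \<in> {{a, b}, {a, c}, {a, d}, {b, c}, {b, d}, {c, d}}"
proof -
  obtain m n where mn: "X = {m, n}" "m \<noteq> n" using assms(2) by (auto simp: card_2_iff)
  then have "m \<in> {a, b, c, d}" "n \<in> {a, b, c, d}" using assms(1) by auto
  with mn show ?thesis by (elim insertE emptyE; simp add: insert_commute)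
qed

text \<open>
  The list \<open>xs\<close> encodes the relabelling: \<open>xs ! i\<close> takes the place of the number \<open>i\<close>.
\<close>
lemma isomorphic_family:
  assumes "k < 15" "inj_on (nth xs) (fst (minimal_families ! k))"
    and "E = nth xs ` fst (minimal_families ! k)"
    and "C = relabel (nth xs) ` snd (minimal_families ! k)"
  shows "\<exists>P\<in>set minimal_families. isomorphic P (E, C)"
proof
  show "minimal_families ! k \<in> set minimal_families"
    using assms(1) by (intro nth_mem) (simp add: minimal_families_def)
  show "isomorphic (minimal_families ! k) (E, C)"
    using assms(2-) by (cases "minimal_families ! k") (auto simp: isomorphic_iff bij_betw_def)
qed

lemmas family_simps = minimal_families_def relabel_def insert_commute

text \<open>
  The combinatorial content of trace-minimality for stems of size 2. Pairs whose support is not the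
  whole ground set do not fail, so circuits can be eliminated wherever they miss an element.
\<close>
locale critical_family =
  fixes E :: "'a set" and C :: "('a set \<times> 'a) set"
  assumes rooted: "C \<subseteq> rooted_sets E"
    and two: "(X, e) \<in> C \<Longrightarrow> card X = 2"
    and critical: "support ` elimination_failures C = {E}"
begin

lemma circuitE:
  assumes "(X, e) \<in> C"
  obtains a b where "X = {a, b}" "distinct [a, b, e]" "a \<in> E" "b \<in> E" "e \<in> E"
proof -
  obtain a b where "X = {a, b}" "a \<noteq> b" using two[OF assms] by (auto simp: card_2_iff)
  moreover have "X \<subseteq> E" "e \<in> E" "e \<notin> X"
    using rooted assms by (auto simp: rooted_sets_def)
  ultimately show ?thesis by (intro that[of a b]) auto
qed

lemma eliminate:
  assumes "(X, e) \<in> C" "(X', e') \<in> C" "e \<in> X'" "X \<union> X' \<union> {e'} \<noteq> E"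
  obtains a b where "a \<noteq> b" "{a, b} \<subseteq> X \<union> X' - {e, e'}" "({a, b}, e') \<in> C"
proof -
  have "((X, e), (X', e')) \<notin> elimination_failures C"
  proof
    assume "((X, e), (X', e')) \<in> elimination_failures C"
    then have "support ((X, e), (X', e')) = E" using critical by blast
    then show False using assms(4) by (simp add: support_def)
  qed
  then obtain S where S: "S \<subseteq> X \<union> X' - {e}" "(S, e') \<in> C"
    using assms unfolding mem_elimination_failures_iff by auto
  obtain a b where "S = {a, b}" "distinct [a, b, e']"
    using S(2) by (rule circuitE)
  then show ?thesis using S by (intro that[of a b]) auto
qed

text \<open>
  Otherwise the only candidate for a stem of root \<open>b\<close> would be a subset of \<open>{a}\<close>, which is too small.
\<close>
lemma root_unique:
  assumes "({a, b}, c) \<in> C" "{a, b, c} \<noteq> E"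
  shows "({a, c}, b) \<notin> C"
proof
  assume "({a, c}, b) \<in> C"
  then show False
    using assms by (elim eliminate[of "{a, b}" c "{a, c}" b]) (auto simp: insert_commute)
qed

text \<open>
  For a pair of circuits that involves at most four elements, elimination has just one possible
  outcome. The two rules treat the two positions of the root of the second circuit: outside the first
  stem, and inside it.
\<close>
lemma eliminate_new_root:
  assumes "({a, b}, c) \<in> C" "({c, a}, d) \<in> C" "{a, b, c, d} \<noteq> E"
  shows "({a, b}, d) \<in> C"
proof -
  obtain p q where "p \<noteq> q" "{p, q} \<subseteq> {a, b} \<union> {c, a} - {c, d}" "({p, q}, d) \<in> C"
    using assms by (elim eliminate[of "{a, b}" c "{c, a}" d]) (auto simp: insert_commute)
  moreover from this have "{p, q} = {a, b}" by auto
  ultimately show ?thesis by simp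
qed

lemma eliminate_old_root:
  assumes "({a, b}, c) \<in> C" "({c, d}, a) \<in> C" "{a, b, c, d} \<noteq> E"
  shows "({b, d}, a) \<in> C"
proof -
  obtain p q where "p \<noteq> q" "{p, q} \<subseteq> {a, b} \<union> {c, d} - {c, a}" "({p, q}, a) \<in> C"
    using assms by (elim eliminate[of "{a, b}" c "{c, d}" a]) (auto simp: insert_commute)
  moreover from this have "{p, q} = {b, d}" by auto
  ultimately show ?thesis by simp
qed

lemma circuit_in_triple:
  assumes "(X, e) \<in> C" "distinct [a, b, c]" "X \<union> {e} \<subseteq> {a, b, c}"
  shows "(X, e) \<in> {({a, b}, c), ({a, c}, b), ({b, c}, a)}"
proof -
  have "e \<notin> X" using assms(1) by (elim circuitE) auto
  then have "X \<subseteq> {a, b, c} - {e}" using assms(3) by blast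
  moreover have "card ({a, b, c} - {e}) = 2" using assms(2,3) by auto
  ultimately have "X = {a, b, c} - {e}"
    using two[OF assms(1)] by (intro card_subset_eq) simp_all
  then show ?thesis using assms(2,3) by auto
qed

lemma three_elements:
  assumes E: "E = {x, y, z}" and dist: "distinct [x, y, z]"
    and C: "({x, y}, z) \<in> C" "({x, z}, y) \<in> C"
  shows "\<exists>P\<in>set minimal_families. isomorphic P (E, C)"
proof -
  have "C \<subseteq> {({x, y}, z), ({x, z}, y), ({y, z}, x)}"
  proof (rule subrelI)
    fix X e assume "(X, e) \<in> C"
    moreover from this have "X \<union> {e} \<subseteq> {x, y, z}" using E by (elim circuitE) auto
    ultimately show "(X, e) \<in> {({x, y}, z), ({x, z}, y), ({y, z}, x)}"
      using dist by (intro circuit_in_triple)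
  qed
  then consider (1) "C = {({x, y}, z), ({x, z}, y)}"
    | (2) "C = {({x, y}, z), ({x, z}, y), ({y, z}, x)}"
    using C by auto
  then show ?thesis
  proof cases
    case 1 then show ?thesis
      using E dist by (intro isomorphic_family[of 0 "[x, y, z]"]) (simp_all add: family_simps)
  next
    case 2 then show ?thesis
      using E dist by (intro isomorphic_family[of 1 "[x, y, z]"]) (simp_all add: family_simps)
  qed
qed

text \<open>
  Two circuits on the same triple would contradict \<open>root_unique\<close>.
\<close>
lemma trace_triple:
  assumes "distinct [a, b, c]" "{a, b, c} \<noteq> E"
  shows "trace_family C {a, b, c} \<in> {{}, {({a, b}, c)}, {({a, c}, b)}, {({b, c}, a)}}"
proof -
  have only_one: "T \<in> {{}, {p}, {q}, {r}}"
    if "T \<subseteq> {p, q, r}" "T \<subseteq> D" "\<not> (p \<in> D \<and> q \<in> D)" "\<not> (p \<in> D \<and> r \<in> D)" "\<not> (q \<in> D \<and> r \<in> D)"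
    for T D and p q r :: "'a set \<times> 'a"
    using that by blast
  show ?thesis
  proof (rule only_one[where D = C])
    show "trace_family C {a, b, c} \<subseteq> {({a, b}, c), ({a, c}, b), ({b, c}, a)}"
      using circuit_in_triple[OF _ assms(1)] by (auto simp: trace_family_def)
    show "trace_family C {a, b, c} \<subseteq> C" by (auto simp: trace_family_def)
  qed (use root_unique[of a b c] root_unique[of b a c] root_unique[of c a b] assms(2) in
      \<open>auto simp: insert_commute\<close>)
qed

lemma trace_triple_eq:
  assumes "({a, b}, c) \<in> C" "{a, b, c} \<noteq> E"
  shows "trace_family C {a, b, c} = {({a, b}, c)}"
proof -
  have dist: "distinct [a, b, c]"
    using two[OF assms(1)] rooted assms(1) by (cases "a = b") (auto simp: rooted_sets_def)
  have "({a, b}, c) \<in> trace_family C {a, b, c}"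
    using assms(1) by (simp add: trace_family_def)
  moreover have "({a, b}, c) \<noteq> ({a, c}, b)" "({a, b}, c) \<noteq> ({b, c}, a)" using dist by auto
  moreover have "T = {p}" if "T \<in> {{}, {p}, {q}, {r}}" "p \<in> T" "p \<noteq> q" "p \<noteq> r"
    for T and p q r :: "'a set \<times> 'a"
    using that by auto
  ultimately show ?thesis
    using trace_triple[OF dist assms(2)] by metis
qed

lemma union_of_triple_traces:
  assumes "E = {p, q, c, s}" "distinct [p, q, c, s]"
  shows "C = trace_family C {p, q, c} \<union> trace_family C {p, c, s} \<union>
    trace_family C {p, q, s} \<union> trace_family C {q, c, s}"
proof -
  have "X \<union> {e} \<subseteq> {p, q, c} \<or> X \<union> {e} \<subseteq> {p, c, s} \<or> X \<union> {e} \<subseteq> {p, q, s} \<or> X \<union> {e} \<subseteq> {q, c, s}"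
    if circuit: "(X, e) \<in> C" for X e
  proof -
    obtain a b where "X = {a, b}" "distinct [a, b, e]" and E': "a \<in> E" "b \<in> E" "e \<in> E"
      by (rule circuitE[OF circuit])
    moreover from this have "card (X \<union> {e}) = 3" by auto
    moreover have "card E = 4" using assms by simp
    ultimately have "\<not> E \<subseteq> X \<union> {e}" using card_mono[of "X \<union> {e}" E] by auto
    then obtain t where "t \<in> E" "t \<notin> X \<union> {e}" by blast
    moreover have "X \<union> {e} \<subseteq> E" using E' \<open>X = {a, b}\<close> by simp
    ultimately show ?thesis using assms(1) by blast
  qed
  then show ?thesis by (auto simp: trace_family_def)
qed

text \<open>
  The failing pair fills the triples \<open>{p, q, c}\<close> and \<open>{p, c, s}\<close>, and its failure means that
  \<open>s\<close> is not the root of \<open>{p, q, s}\<close>. The sets \<open>T\<close> and \<open>U\<close> run through the remaining choices for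
  the triples \<open>{p, q, s}\<close> and \<open>{q, c, s}\<close>; in each case the list of elements is the relabelling.
\<close>
lemma four_elements_new_root:
  assumes E: "E = {p, q, c, s}" and dist: "distinct [p, q, c, s]"
    and C: "({p, q}, c) \<in> C" "({c, p}, s) \<in> C" "({p, q}, s) \<notin> C"
  shows "\<exists>P\<in>set minimal_families. isomorphic P (E, C)"
proof -
  have neq: "p \<noteq> q" "p \<noteq> c" "p \<noteq> s" "q \<noteq> c" "q \<noteq> s" "c \<noteq> s"
    using dist by auto
  have ne: "{p, q, c} \<noteq> E" "{p, c, s} \<noteq> E" "{p, q, s} \<noteq> E" "{q, c, s} \<noteq> E"
    using E dist by auto
  have eq1: "trace_family C {p, q, c} = {({p, q}, c)}"
    using C ne by (intro trace_triple_eq)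
  have eq2: "trace_family C {p, c, s} = {({p, c}, s)}"
    using C ne by (intro trace_triple_eq) (simp_all add: insert_commute)
  have t3: "trace_family C {p, q, s} \<in> {{}, {({p, s}, q)}, {({q, s}, p)}}"
  proof -
    have "({p, q}, s) \<notin> trace_family C {p, q, s}"
      using C(3) by (simp add: trace_family_def)
    then have "trace_family C {p, q, s} \<noteq> {({p, q}, s)}" by (metis singletonI)
    then show ?thesis using trace_triple[of p q s] ne dist by simp
  qed
  have t4: "trace_family C {q, c, s} \<in> {{}, {({q, c}, s)}, {({q, s}, c)}, {({c, s}, q)}}"
    using trace_triple[of q c s] ne dist by simp
  obtain T U where C_eq: "C = {({p, q}, c)} \<union> {({p, c}, s)} \<union> T \<union> U"
      and T: "T \<in> {{}, {({p, s}, q)}, {({q, s}, p)}}"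
      and U: "U \<in> {{}, {({q, c}, s)}, {({q, s}, c)}, {({c, s}, q)}}"
    using union_of_triple_traces[OF E dist, unfolded eq1 eq2] t3 t4 by (rule that)
  from T U consider
      (1) "T = {}" "U = {}"
    | (2) "T = {}" "U = {({q, c}, s)}"
    | (3) "T = {}" "U = {({q, s}, c)}"
    | (4) "T = {}" "U = {({c, s}, q)}"
    | (5) "T = {({q, s}, p)}" "U = {}"
    | (6) "T = {({q, s}, p)}" "U = {({q, c}, s)}"
    | (7) "T = {({q, s}, p)}" "U = {({q, s}, c)}"
    | (8) "T = {({q, s}, p)}" "U = {({c, s}, q)}"
    | (9) "T = {({p, s}, q)}" "U = {}"
    | (10) "T = {({p, s}, q)}" "U = {({q, c}, s)}"
    | (11) "T = {({p, s}, q)}" "U = {({q, s}, c)}"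
    | (12) "T = {({p, s}, q)}" "U = {({c, s}, q)}"
    by (elim insertE emptyE) (rule that, assumption, assumption)+
  then show ?thesis
  proof cases
    case 1 then show ?thesis
      using E neq C_eq by (intro isomorphic_family[of 2 "[q, s, c, p]"]) (simp_all add: family_simps)
  next
    case 2 then show ?thesis
      using E neq C_eq by (intro isomorphic_family[of 6 "[p, q, s, c]"]) (simp_all add: family_simps)
  next
    case 3 then show ?thesis
      using E neq C_eq by (intro isomorphic_family[of 5 "[q, s, p, c]"]) (simp_all add: family_simps)
  next
    case 4 then show ?thesis
      using E neq C_eq by (intro isomorphic_family[of 4 "[p, q, s, c]"]) (simp_all add: family_simps)
  next
    case 5 then show ?thesis
      using E neq C_eq by (intro isomorphic_family[of 4 "[q, s, c, p]"]) (simp_all add: family_simps)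
  next
    case 6 then show ?thesis
      using E neq C_eq by (intro isomorphic_family[of 11 "[s, c, p, q]"]) (simp_all add: family_simps)
  next
    case 7 then show ?thesis
      using E neq C_eq by (intro isomorphic_family[of 12 "[c, p, s, q]"]) (simp_all add: family_simps)
  next
    case 8 then show ?thesis
      using E neq C_eq by (intro isomorphic_family[of 9 "[p, q, s, c]"]) (simp_all add: family_simps)
  next
    case 9 then show ?thesis
      using E neq C_eq by (intro isomorphic_family[of 7 "[q, s, c, p]"]) (simp_all add: family_simps)
  next
    case 10 then show ?thesis
      using E neq C_eq by (intro isomorphic_family[of 11 "[s, c, q, p]"]) (simp_all add: family_simps)
  next
    case 11 then show ?thesis
      using E neq C_eq by (intro isomorphic_family[of 11 "[c, q, s, p]"]) (simp_all add: family_simps)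
  next
    case 12 then show ?thesis
      using E neq C_eq by (intro isomorphic_family[of 11 "[q, s, c, p]"]) (simp_all add: family_simps)
  qed
qed

text \<open>
  The same enumeration for the other shape of a failing pair, where the second root \<open>p\<close> lies in the
  first stem and is the root that \<open>{p, q, s}\<close> must not have.
\<close>
lemma four_elements_old_root:
  assumes E: "E = {p, q, c, s}" and dist: "distinct [p, q, c, s]"
    and C: "({p, q}, c) \<in> C" "({c, s}, p) \<in> C" "({q, s}, p) \<notin> C"
  shows "\<exists>P\<in>set minimal_families. isomorphic P (E, C)"
proof -
  have neq: "p \<noteq> q" "p \<noteq> c" "p \<noteq> s" "q \<noteq> c" "q \<noteq> s" "c \<noteq> s"
    using dist by auto
  have ne: "{p, q, c} \<noteq> E" "{p, c, s} \<noteq> E" "{p, q, s} \<noteq> E" "{q, c, s} \<noteq> E"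
    using E dist by auto
  have eq1: "trace_family C {p, q, c} = {({p, q}, c)}"
    using C ne by (intro trace_triple_eq)
  have eq2: "trace_family C {p, c, s} = {({c, s}, p)}"
    using trace_triple_eq[of c s p] C ne by (simp add: insert_commute)
  have t3: "trace_family C {p, q, s} \<in> {{}, {({p, q}, s)}, {({p, s}, q)}}"
  proof -
    have "({q, s}, p) \<notin> trace_family C {p, q, s}"
      using C(3) by (simp add: trace_family_def)
    then have "trace_family C {p, q, s} \<noteq> {({q, s}, p)}" by (metis singletonI)
    then show ?thesis using trace_triple[of p q s] ne dist by simp
  qed
  have t4: "trace_family C {q, c, s} \<in> {{}, {({q, c}, s)}, {({q, s}, c)}, {({c, s}, q)}}"
    using trace_triple[of q c s] ne dist by simp
  obtain T U where C_eq: "C = {({p, q}, c)} \<union> {({c, s}, p)} \<union> T \<union> U"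
      and T: "T \<in> {{}, {({p, q}, s)}, {({p, s}, q)}}"
      and U: "U \<in> {{}, {({q, c}, s)}, {({q, s}, c)}, {({c, s}, q)}}"
    using union_of_triple_traces[OF E dist, unfolded eq1 eq2] t3 t4 by (rule that)
  from T U consider
      (1) "T = {}" "U = {}"
    | (2) "T = {}" "U = {({q, c}, s)}"
    | (3) "T = {}" "U = {({q, s}, c)}"
    | (4) "T = {}" "U = {({c, s}, q)}"
    | (5) "T = {({p, q}, s)}" "U = {}"
    | (6) "T = {({p, q}, s)}" "U = {({q, c}, s)}"
    | (7) "T = {({p, q}, s)}" "U = {({q, s}, c)}"
    | (8) "T = {({p, q}, s)}" "U = {({c, s}, q)}"
    | (9) "T = {({p, s}, q)}" "U = {}"
    | (10) "T = {({p, s}, q)}" "U = {({q, c}, s)}"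
    | (11) "T = {({p, s}, q)}" "U = {({q, s}, c)}"
    | (12) "T = {({p, s}, q)}" "U = {({c, s}, q)}"
    by (elim insertE emptyE) (rule that, assumption, assumption)+
  then show ?thesis
  proof cases
    case 1 then show ?thesis
      using E neq C_eq by (intro isomorphic_family[of 3 "[q, p, s, c]"]) (simp_all add: family_simps)
  next
    case 2 then show ?thesis
      using E neq C_eq by (intro isomorphic_family[of 4 "[q, p, s, c]"]) (simp_all add: family_simps)
  next
    case 3 then show ?thesis
      using E neq C_eq by (intro isomorphic_family[of 5 "[q, p, s, c]"]) (simp_all add: family_simps)
  next
    case 4 then show ?thesis
      using E neq C_eq by (intro isomorphic_family[of 8 "[p, q, s, c]"]) (simp_all add: family_simps)
  next
    case 5 then show ?thesis
      using E neq C_eq by (intro isomorphic_family[of 8 "[c, s, q, p]"]) (simp_all add: family_simps)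
  next
    case 6 then show ?thesis
      using E neq C_eq by (intro isomorphic_family[of 12 "[s, c, p, q]"]) (simp_all add: family_simps)
  next
    case 7 then show ?thesis
      using E neq C_eq by (intro isomorphic_family[of 12 "[c, s, p, q]"]) (simp_all add: family_simps)
  next
    case 8 then show ?thesis
      using E neq C_eq by (intro isomorphic_family[of 10 "[p, q, c, s]"]) (simp_all add: family_simps)
  next
    case 9 then show ?thesis
      using E neq C_eq by (intro isomorphic_family[of 4 "[s, c, q, p]"]) (simp_all add: family_simps)
  next
    case 10 then show ?thesis
      using E neq C_eq by (intro isomorphic_family[of 9 "[p, s, c, q]"]) (simp_all add: family_simps)
  next
    case 11 then show ?thesis
      using E neq C_eq by (intro isomorphic_family[of 11 "[c, q, p, s]"]) (simp_all add: family_simps)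
  next
    case 12 then show ?thesis
      using E neq C_eq by (intro isomorphic_family[of 12 "[q, p, c, s]"]) (simp_all add: family_simps)
  qed
qed

text \<open>
  Any two circuits that together miss an element of the ground set can be eliminated. A further
  circuit either shares a triple with a circuit of the failing pair or, eliminated with one of them,
  yields a circuit that is already excluded; the exclusions start from the three circuits that would
  repair the failing pair. Exchanging \<open>x\<close> and \<open>y\<close> preserves the situation, so most exclusions come
  in pairs.
\<close>
lemma five_elements:
  assumes E: "E = {x, y, z, u, v}" and dist: "distinct [x, y, z, u, v]"
    and C: "({x, y}, z) \<in> C" "({z, v}, u) \<in> C"
    and no: "({x, y}, u) \<notin> C" "({x, v}, u) \<notin> C" "({y, v}, u) \<notin> C"
  shows "\<exists>P\<in>set minimal_families. isomorphic P (E, C)"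
proof -
  have proper: "{a, b, c, d} \<noteq> E" for a b c d
    using card_insert_le_m1[of 4 "{b, c, d}" a] card_insert_le_m1[of 3 "{c, d}" b]
      card_insert_le_m1[of 2 "{d}" c] E dist by auto
  have A: "({a, b}, c) \<in> C \<Longrightarrow> ({c, d}, a) \<in> C \<Longrightarrow> ({b, d}, a) \<in> C" for a b c d
    using eliminate_old_root proper by blast
  have B: "({a, b}, c) \<in> C \<Longrightarrow> ({c, a}, d) \<in> C \<Longrightarrow> ({a, b}, d) \<in> C" for a b c d
    using eliminate_new_root proper by blast
  have R: "({a, b}, c) \<in> C \<Longrightarrow> ({a, c}, b) \<notin> C" for a b c
    using root_unique[of a b c] proper[of a b c c] by simp
  have n1: "({u, x}, z) \<notin> C" "({u, y}, z) \<notin> C"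
    using A[of u x z v] A[of u y z v] C no
    by (auto simp: insert_commute)
  have n2: "({z, u}, x) \<notin> C" "({z, u}, y) \<notin> C"
    using A[of z u x y] A[of z u y x] n1 C no
    by (auto simp: insert_commute)
  have n3: "({v, x}, z) \<notin> C" "({v, y}, z) \<notin> C"
    using B[of v x z u] B[of v y z u] C no
    by (auto simp: insert_commute)
  have n4: "({u, x}, y) \<notin> C" "({u, y}, x) \<notin> C"
    using B[of x u y z] B[of y u x z] n1 C no
    by (auto simp: insert_commute)
  have n5: "({v, x}, y) \<notin> C" "({v, y}, x) \<notin> C"
    using B[of x v y z] B[of y v x z] n3 C no
    by (auto simp: insert_commute)
  have n6: "({x, z}, u) \<notin> C" "({y, z}, u) \<notin> C"
    using B[of x y z u] B[of y x z u] C no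
    by (auto simp: insert_commute)
  have n7: "({x, z}, v) \<notin> C" "({y, z}, v) \<notin> C"
    using B[of z x v u] B[of z y v u] n6 C no
    by (auto simp: insert_commute)
  have n8: "({x, z}, y) \<notin> C" "({y, z}, x) \<notin> C"
    using R[of x y z] R[of y x z] C no
    by (auto simp: insert_commute)
  have n9: "({u, x}, v) \<notin> C" "({u, y}, v) \<notin> C"
    using A[of u x v z] A[of u y v z] n6 C no
    by (auto simp: insert_commute)
  have n10: "({v, z}, x) \<notin> C" "({v, z}, y) \<notin> C"
    using A[of x y z v] A[of y x z v] n5 C no
    by (auto simp: insert_commute)
  have n11: "({u, v}, x) \<notin> C" "({u, v}, y) \<notin> C"
    using B[of v z u x] B[of v z u y] n10 C no
    by (auto simp: insert_commute)
  have n12: "({u, v}, z) \<notin> C" "({u, z}, v) \<notin> C"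
    using R[of v u z] R[of z u v] R[of z v u] C by (auto simp: insert_commute)
  note none = n1 n2 n3 n4 n5 n6 n7 n8 n9 n10 n11 n12 no
  have "C \<subseteq> {({x, y}, z), ({z, v}, u), ({x, y}, v)}"
  proof (rule subrelI)
    fix X e assume X: "(X, e) \<in> C"
    then have "e \<in> {x, y, z, v, u}" "X \<subseteq> {x, y, z, v, u} - {e}"
      using rooted E by (auto simp: rooted_sets_def)
    then consider "e = x" "X \<subseteq> {y, z, v, u}" | "e = y" "X \<subseteq> {x, z, v, u}"
      | "e = z" "X \<subseteq> {x, y, v, u}" | "e = v" "X \<subseteq> {x, y, z, u}" | "e = u" "X \<subseteq> {x, y, z, v}"
      by blast
    then show "(X, e) \<in> {({x, y}, z), ({z, v}, u), ({x, y}, v)}"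
    proof cases
      case 1
      then show ?thesis using two_subset_of_four[OF 1(2) two[OF X]] X none
        by (elim insertE emptyE; simp add: insert_commute)
    next
      case 2
      then show ?thesis using two_subset_of_four[OF 2(2) two[OF X]] X none
        by (elim insertE emptyE; simp add: insert_commute)
    next
      case 3
      then show ?thesis using two_subset_of_four[OF 3(2) two[OF X]] X none
        by (elim insertE emptyE; simp add: insert_commute)
    next
      case 4
      then show ?thesis using two_subset_of_four[OF 4(2) two[OF X]] X none
        by (elim insertE emptyE; simp add: insert_commute)
    next
      case 5
      then show ?thesis using two_subset_of_four[OF 5(2) two[OF X]] X none
        by (elim insertE emptyE; simp add: insert_commute)
    qed
  qed
  then consider (1) "C = {({x, y}, z), ({z, v}, u)}"
    | (2) "C = {({x, y}, z), ({z, v}, u), ({x, y}, v)}"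
    using C by auto
  then show ?thesis
  proof cases
    case 1 then show ?thesis
      using E dist by (intro isomorphic_family[of 13 "[x, y, z, u, v]"]) (simp_all add: family_simps)
  next
    case 2 then show ?thesis
      using E dist by (intro isomorphic_family[of 14 "[x, y, z, u, v]"]) (simp_all add: family_simps)
  qed
qed

text \<open>
  The two circuits of a failing pair are \<open>({x, y}, z)\<close> and \<open>({z, v}, u)\<close>. Which of \<open>u\<close> and \<open>v\<close>
  occur in \<open>{x, y}\<close> determines the size of the ground set and the shape of the pair.
\<close>
lemma classification: "\<exists>P\<in>set minimal_families. isomorphic P (E, C)"
proof -
  have "elimination_failures C \<noteq> {}" using critical by auto
  then obtain X z X' u where failure: "((X, z), (X', u)) \<in> elimination_failures C"
    by (metis all_not_in_conv surj_pair)
  then have "support ((X, z), (X', u)) = E" using critical by blast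
  then have E: "E = X \<union> X' \<union> {u}" by (simp add: support_def)
  have mem: "(X, z) \<in> C" "(X', u) \<in> C" "z \<in> X'"
    and no: "\<And>S. S \<subseteq> X \<union> X' - {z} \<Longrightarrow> (S, u) \<notin> C"
    using failure unfolding mem_elimination_failures_iff by simp_all
  obtain x y where X: "X = {x, y}" "x \<noteq> y" "x \<noteq> z" "y \<noteq> z"
    using circuitE[OF mem(1)] by (metis distinct_length_2_or_more)
  obtain v where X': "X' = {z, v}" "v \<noteq> z" "u \<noteq> z" "u \<noteq> v"
  proof -
    obtain a b where "X' = {a, b}" "distinct [a, b, u]" using mem(2) by (rule circuitE)
    then show ?thesis using mem(3) that[of a] that[of b] by auto
  qed
  have C: "({x, y}, z) \<in> C" "({z, v}, u) \<in> C" using mem X X' by auto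
  have E: "E = {x, y, z, u, v}" using E X X' by auto
  have no: "({x, y}, u) \<notin> C" "({x, v}, u) \<notin> C" "({y, v}, u) \<notin> C"
    using no[of "{x, y}"] no[of "{x, v}"] no[of "{y, v}"] X X' by auto
  have swap: "({y, x}, z) \<in> C" "({y, x}, u) \<notin> C" using C no by (simp_all add: insert_commute)
  consider "v \<notin> {x, y}" "u \<notin> {x, y}" | "v = x" "u \<notin> {x, y}" | "v = y" "u \<notin> {x, y}"
    | "u = x" "v \<notin> {x, y}" | "u = y" "v \<notin> {x, y}" | "v = x" "u = y" | "v = y" "u = x"
    using X' by auto
  then show ?thesis
  proof cases
    case 1 then show ?thesis using E X X' C no by (intro five_elements[of x y z u v]) auto
  next
    case 2 then show ?thesis using E X X' C no by (intro four_elements_new_root[of x y z u]) auto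
  next
    case 3 then show ?thesis using E X X' C swap by (intro four_elements_new_root[of y x z u]) auto
  next
    case 4 then show ?thesis using E X X' C no by (intro four_elements_old_root[of x y z v]) auto
  next
    case 5 then show ?thesis using E X X' swap C no by (intro four_elements_old_root[of y x z v]) auto
  next
    case 6 then show ?thesis using E X X' C
      by (intro three_elements[of x y z]) (auto simp: insert_commute)
  next
    case 7 then show ?thesis using E X X' C swap
      by (intro three_elements[of y x z]) (auto simp: insert_commute)
  qed
qed

end

section \<open>Classification of the minimal families\<close>

theorem theorem24:
  shows "(\<forall>(E :: 'a set) C. finite E \<longrightarrow>
            (trace_minimal_non_convex_geometry2 E C \<longleftrightarrow>
              (\<exists>P\<in>set minimal_families. isomorphic P (E, C))))
         \<and> (\<forall>(E, C)\<in>set minimal_families. trace_minimal_non_convex_geometry2 E C)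
         \<and> length minimal_families = 15
         \<and> (\<forall>i<15. \<forall>j<15. i \<noteq> j \<longrightarrow>
              \<not> isomorphic (minimal_families ! i) (minimal_families ! j))"
proof -
  have length: "length minimal_families = 15" by (simp add: minimal_families_def)
  have minimal: "trace_minimal_non_convex_geometry2 F D" if "(F, D) \<in> set minimal_families" for F D
    using bspec[OF minimal_families_rooted that]
      bspec[OF minimal_families_failures[unfolded list_all_iff] that] trace_minimal_iff[of F D]
    by simp
  have complete: "\<exists>P\<in>set minimal_families. isomorphic P (E, C)"
    if "finite E" "trace_minimal_non_convex_geometry2 E C" for E :: "'a set" and C
  proof -
    have "C \<subseteq> rooted_sets E" "\<forall>(X, e)\<in>C. card X = 2"
      using that(2) by (simp_all add: trace_minimal_non_convex_geometry2_def)
    then interpret critical_family E C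
      using that trace_minimal_iff[of E C] by unfold_locales auto
    show ?thesis by (rule classification)
  qed
  have sound: "trace_minimal_non_convex_geometry2 E C"
    if "P \<in> set minimal_families" "isomorphic P (E, C)" for E :: "'a set" and C P
  proof (cases P)
    case (Pair F D)
    then show ?thesis
      using that minimal[of F D] minimal_families_rooted trace_minimal_isomorphic[of F D E C] by auto
  qed
  have distinct: "\<not> isomorphic (minimal_families ! i) (minimal_families ! j)"
    if "i < 15" "j < 15" "i \<noteq> j" for i j
  proof
    assume iso: "isomorphic (minimal_families ! i) (minimal_families ! j)"
    obtain F D G H where FD: "minimal_families ! i = (F, D)" and GH: "minimal_families ! j = (G, H)"
      by fastforce
    have "(F, D) \<in> set minimal_families"
      using that length FD nth_mem[of i minimal_families] by simp
    then have "D \<subseteq> rooted_sets F" using bspec[OF minimal_families_rooted, of "(F, D)"] by simp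
    then have "invariant (minimal_families ! i) = invariant (minimal_families ! j)"
      using iso FD GH by (simp add: invariant_isomorphic)
    then show False
      using that length distinct_invariants by (simp add: distinct_conv_nth)
  qed
  show ?thesis
  proof (intro conjI)
    show "\<forall>(E :: 'a set) C. finite E \<longrightarrow>
        (trace_minimal_non_convex_geometry2 E C \<longleftrightarrow>
          (\<exists>P\<in>set minimal_families. isomorphic P (E, C)))"
      by (intro allI impI iffI complete) (auto elim!: bexE intro: sound)
    show "\<forall>(E, C)\<in>set minimal_families. trace_minimal_non_convex_geometry2 E C"
      by (intro ballI) (simp add: split_beta minimal)
  qed (use length distinct in simp_all)
qed

end
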